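(* For every instance of the Probabilistic Profitable Tour Problem on a line with $n$ customers $N=\{v_1,\dots,v_n\}$, the algorithm PPTPLine$(N)$ (described in the context) returns the description of the function $c\mapsto PPTP(N,c)$, $c\in[0,+\infty)$, in computational time $O(n^3)$.
   Context: Setting (PPTP on a line). The depot is at the origin of the half-line $[0,\infty)$. $N=\{v_1,\dots,v_n\}$ ($n\ge 1$) is the set of potential customers; customer $v_i$ has position $x_i>0$, prize $p_i>0$ and probability $\pi_i\in(0,1]$. Customers are indexed so that $x_i\le x_{i+1}$, and $x_i=x_{i+1}$ implies $\pi_i\le\pi_{i+1}$. Put $l_i=2x_i$. For $S\subseteq N$ define the expected revenue $R(S)=\sum_{v_i\in S}\pi_ip_i$, the expected distance $L(S)=\sum_{v_i\in S} l_i\pi_i\prod_{v_j\in S,\,j>i}(1-\pi_j)$ and, for a unit cost $c\ge 0$, the expected profit $G(S,c)=R(S)-cL(S)$. Empty sums are $0$, empty products are $1$. For $M\subseteq N$, $PPTP(M,c)=\max_{S\subseteq M}G(S,c)$; a set attaining the maximum is an optimal set for $c$, and a maximal optimal set is an optimal set that is maximal with respect to inclusion. Let $N^{(k)}=\{v_1,\dots,v_k\}$, $N^{(0)}=\emptyset$. The (minimal) description $D^{(k)}$ of $c\mapsto PPTP(N^{(k)},c)$ consists of: the list $S_1,\dots,S_m$ of the distinct sets that are the optimal sets on the successive linear pieces of this function, ordered by increasing $c$ (so $S_1=N^{(k)}$ and $S_m=\emptyset$), together with the values $C_i^{\min}$ and $C_i^{\max}$, the minimum and maximum values of $c$ for which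 $S_i$ is optimal for the problem on $N^{(k)}$ ($C_1^{\min}=0$, $C_m^{\max}=+\infty$, and otherwise $C_i^{\max}=C_{i+1}^{\min}$ is the value of $c$ such that $G(S_i,c)=G(S_{i+1},c)$). Algorithm PPTPLine$(N)$: start with $D^{(0)}$ given by the list $[\emptyset]$ with $C_1^{\min}=0$, $C_1^{\max}=\infty$. For $k=0,\dots,n-1$: form $E^{(k)}=\{S_i\cup\{v_{k+1}\} : S_i \text{ in the list of } D^{(k)}\}$ and let $D^{(k+1)}=\mathrm{JointSortFilter}(D^{(k)},E^{(k)})$. Return $D^{(n)}$. The function JointSortFilter creates the upper envelope, on $c\in[0,+\infty)$, of the lines $c\mapsto G(S,c)$ for $S$ in $D^{(k)}$ or $E^{(k)}$: the sets of $D^{(k)}$, already sorted, give the starting envelope; the sets of $E^{(k)}$ are added one at a time, each being compared with the sets of the current envelope and modifying it accordingly; sets of $E^{(k)}$ that do not modify the envelope are discarded, as are sets of the existing envelope that become dominated by the insertion of a new set. Time is measured in elementary operations, with unit-cost arithmetic and comparisons of real numbers. *)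

theory Defs
  imports
    "HOL-Library.Extended_Real"
    "HOL-Library.Landau_Symbols"
    "HOL-Library.Monad_Syntax"
begin

section \<open>The problem\<close>

text \<open>Customer \<open>v\<^sub>i\<close> is identified with its index \<open>i \<in> {1..n}\<close>; only the values of the
  three functions on \<open>{1..n}\<close> are relevant.\<close>

record pptp =
  num :: nat
  pos :: "nat \<Rightarrow> real"
  prize :: "nat \<Rightarrow> real"
  prob :: "nat \<Rightarrow> real"

definition pptp_instance :: "pptp \<Rightarrow> bool" where
  "pptp_instance I \<longleftrightarrow>
     1 \<le> num I \<and>
     (\<forall>i\<in>{1..num I}. 0 < pos I i \<and> 0 < prize I i \<and> 0 < prob I i \<and> prob I i \<le> 1) \<and>
     (\<forall>i\<in>{1..<num I}. pos I i \<le> pos I (i + 1) \<and>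
        (pos I i = pos I (i + 1) \<longrightarrow> prob I i \<le> prob I (i + 1)))"

definition R :: "pptp \<Rightarrow> nat set \<Rightarrow> real" where
  "R I S = (\<Sum>i\<in>S. prob I i * prize I i)"

definition L :: "pptp \<Rightarrow> nat set \<Rightarrow> real" where
  "L I S = (\<Sum>i\<in>S. (2 * pos I i) * prob I i * (\<Prod>j\<in>{j\<in>S. i < j}. 1 - prob I j))"

definition G :: "pptp \<Rightarrow> nat set \<Rightarrow> real \<Rightarrow> real" where
  "G I S c = R I S - c * L I S"

definition PPTP :: "pptp \<Rightarrow> nat set \<Rightarrow> real \<Rightarrow> real" where
  "PPTP I M c = Max ((\<lambda>S. G I S c) ` Pow M)"

definition optimal :: "pptp \<Rightarrow> nat set \<Rightarrow> nat set \<Rightarrow> real \<Rightarrow> bool" where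
  "optimal I M S c \<longleftrightarrow> S \<subseteq> M \<and> G I S c = PPTP I M c"

text \<open>\<open>is_description I k D\<close>: the list \<open>D\<close> of triples \<open>(S i, Cmin i, Cmax i)\<close>, \<open>i = 1, \<dots>, m\<close>, is the minimal
  description of \<open>c \<mapsto> PPTP I {1..k} c\<close> on \<open>[0, \<infinity>)\<close>.  The listed sets are those that are optimal
  on an interval of positive length, so a set that is optimal only at a breakpoint is not listed.
  Two consecutive sets have the same profit for one value of \<open>c\<close> only; hence their slopes differ,
  and the intervals \<open>[Cmin i, Cmax i]\<close> are the maximal linear pieces.\<close>

definition is_description ::
    "pptp \<Rightarrow> nat \<Rightarrow> (nat set \<times> ereal \<times> ereal) list \<Rightarrow> bool" where
  "is_description I k D \<longleftrightarrow>
     (\<exists>m S Cmin Cmax.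
        D = map (\<lambda>i. (S i, Cmin i, Cmax i)) [1..<Suc m] \<and>
        1 \<le> m \<and> inj_on S {1..m} \<and> S 1 = {1..k} \<and> S m = {} \<and>
        S ` {1..m} =
          {T. \<exists>a b. 0 \<le> a \<and> a < b \<and> (\<forall>c\<in>{a..b}. optimal I {1..k} T c)} \<and>
        (\<forall>i\<in>{1..m}. Cmin i < Cmax i \<and>
           {c. 0 \<le> c \<and> optimal I {1..k} (S i) c} = {c. Cmin i \<le> ereal c \<and> ereal c \<le> Cmax i}) \<and>
        Cmin 1 = 0 \<and> Cmax m = \<infinity> \<and>
        (\<forall>i\<in>{1..<m}. Cmax i = Cmin (i + 1) \<and>
           (\<forall>c. G I (S i) c = G I (S (i + 1)) c \<longleftrightarrow> ereal c = Cmax i)))"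


section \<open>Counting elementary operations\<close>

text \<open>A computation returns a value and the number of elementary operations it has executed.
  Programs below obey the following discipline: the argument of every \<open>elem\<close> is exactly one
  elementary operation, namely one arithmetic operation or comparison of (extended) real numbers
  (\<open>min\<close> and \<open>max\<close> included), one access to the input data, or the allocation of one constant-size
  record or list cell; every function call is charged one operation by \<open>tick\<close>.  Conditionals on
  computed truth values, and the decomposition of constant-size data by patterns and selectors,
  occur only a constant number of times per call and are covered by that charge.\<close>

datatype 'a timed = Timed (val: 'a) (steps: nat)

definition return :: "'a \<Rightarrow> 'a timed" where
  "return x = Timed x 0"

definition elem :: "'a \<Rightarrow> 'a timed" where
  "elem x = Timed x 1"

definition tick :: "'a timed \<Rightarrow> 'a timed" where
  "tick m = Timed (val m) (steps m + 1)"

definition bind_timed :: "'a timed \<Rightarrow> ('a \<Rightarrow> 'b timed) \<Rightarrow> 'b timed" where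
  "bind_timed m f = Timed (val (f (val m))) (steps m + steps (f (val m)))"

adhoc_overloading Monad_Syntax.bind \<rightleftharpoons> bind_timed


section \<open>The algorithm\<close>

text \<open>A set \<open>S\<close> is stored as the list of its members together with the coefficients \<open>R I S\<close>
  and \<open>L I S\<close> of its line \<open>c \<mapsto> G I S c\<close>.  An entry of an envelope also stores the
  interval \<open>[Cmin, Cmax]\<close> on which its line attains the envelope; envelopes are sorted by
  increasing \<open>c\<close>, i.e. by strictly decreasing \<open>dst\<close>.\<close>

datatype line = Line (members: "nat list") (rvn: real) (dst: real)

type_synonym entry = "line \<times> ereal \<times> ereal"

text \<open>The recursion for the distance is
  \<open>L I (S \<union> {k}) = l\<^sub>k \<pi>\<^sub>k + (1 - \<pi>\<^sub>k) L I S\<close> for \<open>S \<subseteq> {1..<k}\<close>.\<close>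

definition extend :: "pptp \<Rightarrow> nat \<Rightarrow> line \<Rightarrow> line timed" where
  "extend I k s = tick (do {
     x \<leftarrow> elem (pos I k);
     p \<leftarrow> elem (prize I k);
     q \<leftarrow> elem (prob I k);
     r \<leftarrow> elem (q * p);
     r \<leftarrow> elem (rvn s + r);
     l \<leftarrow> elem (2 * x);
     l \<leftarrow> elem (l * q);
     t \<leftarrow> elem (1 - q);
     t \<leftarrow> elem (t * dst s);
     l \<leftarrow> elem (l + t);
     S \<leftarrow> elem (k # members s);
     elem (Line S r l)
   })"

fun extend_all :: "pptp \<Rightarrow> nat \<Rightarrow> entry list \<Rightarrow> line list timed" where
  "extend_all I k [] = tick (return [])"
| "extend_all I k ((s, _, _) # D) = tick (do {
     h \<leftarrow> extend I k s;
     E \<leftarrow> extend_all I k D;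
     elem (h # E)
   })"

text \<open>\<open>beats h e\<close> returns bounds \<open>(lo, hi)\<close> such that, for \<open>c > 0\<close>, the line \<open>h\<close> is strictly
  above the line \<open>e\<close> at \<open>c\<close> iff \<open>lo < c < hi\<close>.\<close>

definition beats :: "line \<Rightarrow> line \<Rightarrow> (ereal \<times> ereal) timed" where
  "beats h e = tick (do {
     flatter \<leftarrow> elem (dst h < dst e);
     steeper \<leftarrow> elem (dst e < dst h);
     if flatter then do {
       r \<leftarrow> elem (rvn e - rvn h);
       l \<leftarrow> elem (dst e - dst h);
       c \<leftarrow> elem (r / l);
       return (ereal c, \<infinity>)
     } else if steeper then do {
       r \<leftarrow> elem (rvn h - rvn e);
       l \<leftarrow> elem (dst h - dst e);
       c \<leftarrow> elem (r / l);
       return (0, ereal c)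
     } else do {
       above \<leftarrow> elem (rvn e < rvn h);
       return (if above then (0, \<infinity>) else (0, 0))
     }
   })"

fun window :: "line \<Rightarrow> entry list \<Rightarrow> (ereal \<times> ereal) timed" where
  "window h [] = tick (return (0, \<infinity>))"
| "window h ((e, _, _) # D) = tick (do {
     (lo, hi) \<leftarrow> beats h e;
     (u, w) \<leftarrow> window h D;
     u \<leftarrow> elem (max lo u);
     w \<leftarrow> elem (min hi w);
     return (u, w)
   })"

text \<open>Once the line \<open>h\<close> is known to modify the envelope, on \<open>[u, w]\<close>, the entries that are
  steeper than \<open>h\<close> are cut at \<open>u\<close>, the other ones at \<open>w\<close>, and an entry whose interval thereby
  becomes empty or a single point is dominated and deleted.\<close>

fun cut_right :: "ereal \<Rightarrow> entry list \<Rightarrow> entry list timed" where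
  "cut_right w [] = tick (return [])"
| "cut_right w ((e, a, b) # D) = tick (do {
     D' \<leftarrow> cut_right w D;
     a' \<leftarrow> elem (max a w);
     keep \<leftarrow> elem (a' < b);
     if keep then elem ((e, a', b) # D') else return D'
   })"

fun place :: "line \<Rightarrow> ereal \<Rightarrow> ereal \<Rightarrow> entry list \<Rightarrow> entry list timed" where
  "place h u w [] = tick (elem [(h, u, w)])"
| "place h u w ((e, a, b) # D) = tick (do {
     steeper \<leftarrow> elem (dst h < dst e);
     if steeper then do {
       D' \<leftarrow> place h u w D;
       b' \<leftarrow> elem (min b u);
       keep \<leftarrow> elem (a < b');
       if keep then elem ((e, a, b') # D') else return D'
     } else do {
       D' \<leftarrow> cut_right w ((e, a, b) # D);
       elem ((h, u, w) # D')
     }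
   })"

definition insert_line :: "line \<Rightarrow> entry list \<Rightarrow> entry list timed" where
  "insert_line h D = tick (do {
     (u, w) \<leftarrow> window h D;
     modifies \<leftarrow> elem (u < w);
     if modifies then place h u w D else return D
   })"

fun joint_sort_filter :: "entry list \<Rightarrow> line list \<Rightarrow> entry list timed" where
  "joint_sort_filter D [] = tick (return D)"
| "joint_sort_filter D (h # E) = tick (do {
     D' \<leftarrow> insert_line h D;
     joint_sort_filter D' E
   })"

fun pptp_loop :: "pptp \<Rightarrow> nat \<Rightarrow> entry list timed" where
  "pptp_loop I 0 = tick (do {
     s \<leftarrow> elem (Line [] 0 0);
     elem [(s, 0, \<infinity>)]
   })"
| "pptp_loop I (Suc k) = tick (do {
     D \<leftarrow> pptp_loop I k;
     E \<leftarrow> extend_all I (Suc k) D;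
     joint_sort_filter D E
   })"

fun strip :: "entry list \<Rightarrow> (nat list \<times> ereal \<times> ereal) list timed" where
  "strip [] = tick (return [])"
| "strip ((s, a, b) # D) = tick (do {
     Q \<leftarrow> strip D;
     elem ((members s, a, b) # Q)
   })"

definition pptp_line :: "pptp \<Rightarrow> (nat list \<times> ereal \<times> ereal) list timed" where
  "pptp_line I = tick (do {
     D \<leftarrow> pptp_loop I (num I);
     strip D
   })"

end

theory Submission
  imports Defs
begin

text \<open>The number \<open>L I S\<close> is the expectation of twice the position of the farthest customer of
  \<open>S\<close> that is present (zero if there is none). A maximum is a submodular set function, hence so is
  \<open>L\<close>; it is also monotone. Consequently \<open>G I _ c\<close> is supermodular for \<open>c \<ge> 0\<close>, and raising \<open>c\<close>
  penalises larger sets more. Because all prizes are positive, this forces every optimal set for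
  a larger \<open>c\<close> to be contained in every optimal set for a smaller \<open>c\<close>
  (\<open>optimal_antimono\<close>). Two consequences carry the theorem. First, the sets on the linear pieces of
  \<open>PPTP I {1..k}\<close> form a strictly decreasing chain, so there are at most \<open>k + 1\<close> pieces
  (\<open>length_le\<close>). Second, a set that is optimal on an interval of positive length is the only such
  set (\<open>optimal_unique\<close>), so a list with one entry per piece names all of them.

  For correctness, the profit of \<open>S \<union> {k + 1}\<close> at cost \<open>c\<close> is, up to a term that does not depend on
  \<open>S\<close>, the profit of \<open>S\<close> at cost \<open>(1 - \<pi>) c\<close>, where \<open>\<pi>\<close> is the probability of customer \<open>k + 1\<close>.
  An optimal set for \<open>{1..k+1}\<close> is thus an optimal set for \<open>{1..k}\<close>, with customer \<open>k + 1\<close> added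
  or not (\<open>PPTP_Suc\<close>), and it remains to see that inserting a line turns the description of a
  function \<open>F\<close> into the description of the maximum of \<open>F\<close> and that line (\<open>envelope_insert\<close>).
  For the running time, at most \<open>k + 1\<close> lines are inserted in round \<open>k + 1\<close> into a list that never
  exceeds \<open>2 k + 2\<close> entries, which is quadratic in \<open>k\<close> per round and cubic in total.\<close>

section \<open>Submodularity of the expected distance\<close>

text \<open>Conditioning on the presence of the last customer: if present, it is the farthest one.
  All later facts about \<open>L\<close> are inductions on the number of customers along this equation.\<close>

lemma L_Suc:
  assumes "S \<subseteq> {1..Suc k}"
  shows "L I S = (if Suc k \<in> S
     then 2 * pos I (Suc k) * prob I (Suc k) + (1 - prob I (Suc k)) * L I (S \<inter> {1..k})
     else L I (S \<inter> {1..k}))"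
proof (cases "Suc k \<in> S")
  case True
  define T where "T = S \<inter> {1..k}"
  have S: "S = insert (Suc k) T" and fin: "finite T" and notin: "Suc k \<notin> T" and below: "T \<subseteq> {1..k}"
    using assms True unfolding T_def by (auto simp: le_Suc_eq)
  have top: "{j \<in> insert (Suc k) T. Suc k < j} = {}"
    using below by auto
  have factor: "(\<Prod>j\<in>{j \<in> insert (Suc k) T. i < j}. 1 - prob I j)
      = (1 - prob I (Suc k)) * (\<Prod>j\<in>{j \<in> T. i < j}. 1 - prob I j)" if "i \<in> T" for i
  proof -
    have "{j \<in> insert (Suc k) T. i < j} = insert (Suc k) {j \<in> T. i < j}"
      using that below by auto
    then show ?thesis
      using fin notin by simp
  qed
  have "L I S = 2 * pos I (Suc k) * prob I (Suc k)
      + (\<Sum>i\<in>T. 2 * pos I i * prob I i * (\<Prod>j\<in>{j \<in> insert (Suc k) T. i < j}. 1 - prob I j))"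
    unfolding L_def S sum.insert[OF fin notin] top by simp
  also have "(\<Sum>i\<in>T. 2 * pos I i * prob I i * (\<Prod>j\<in>{j \<in> insert (Suc k) T. i < j}. 1 - prob I j))
      = (1 - prob I (Suc k)) * L I T"
    unfolding L_def sum_distrib_left by (intro sum.cong) (simp_all only: factor mult_ac)
  finally show ?thesis
    using True by (simp add: T_def)
next
  case False
  then have "S \<inter> {1..k} = S"
    using assms by (auto simp: le_Suc_eq)
  then show ?thesis
    using False by simp
qed

lemma L_empty [simp]: "L I {} = 0"
  by (simp add: L_def)

lemma R_empty [simp]: "R I {} = 0"
  by (simp add: R_def)

lemma PPTP_ge: "finite M \<Longrightarrow> S \<subseteq> M \<Longrightarrow> G I S c \<le> PPTP I M c"
  unfolding PPTP_def by (intro Max_ge) auto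

lemma optimal_iff: "finite M \<Longrightarrow> optimal I M S c \<longleftrightarrow> S \<subseteq> M \<and> (\<forall>T\<subseteq>M. G I T c \<le> G I S c)"
  using Max_eq_iff[of "(\<lambda>S. G I S c) ` Pow M" "G I S c"]
  unfolding optimal_def PPTP_def by (auto simp: eq_commute[of "G I S c"])

context
  fixes I :: pptp
  assumes inst: "pptp_instance I"
begin

lemma customer_data:
  assumes "i \<in> {1..num I}"
  shows "0 < pos I i" "0 < prize I i" "0 < prob I i" "prob I i \<le> 1"
  using inst assms by (auto simp: pptp_instance_def)

lemma pos_Suc: "1 \<le> k \<Longrightarrow> Suc k \<le> num I \<Longrightarrow> pos I k \<le> pos I (Suc k)"
  using inst by (auto simp: pptp_instance_def)

text \<open>The farthest customer of \<open>{1..k}\<close> is \<open>k\<close>, which makes it an upper bound: here the order of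
  the positions enters. With it, adding customer \<open>k + 1\<close> replaces the old expectation by a
  weighted mean of that and something at least as large, which gives monotonicity.\<close>

lemma L_bounds:
  assumes "k \<le> num I" "S \<subseteq> {1..k}"
  shows "0 \<le> L I S \<and> (1 \<le> k \<longrightarrow> L I S \<le> 2 * pos I k)"
  using assms
proof (induction k arbitrary: S)
  case 0
  then show ?case by simp
next
  case (Suc k)
  let ?x = "pos I (Suc k)" and ?q = "prob I (Suc k)" and ?T = "S \<inter> {1..k}"
  have d: "0 < ?x" "0 < ?q" "?q \<le> 1"
    using customer_data[of "Suc k"] Suc.prems by auto
  have IH: "0 \<le> L I ?T" "1 \<le> k \<Longrightarrow> L I ?T \<le> 2 * pos I k"
    using Suc.IH[of ?T] Suc.prems by auto
  have le: "L I ?T \<le> 2 * ?x"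
  proof (cases "1 \<le> k")
    case True
    then show ?thesis
      using IH(2) pos_Suc[of k] Suc.prems by force
  next
    case False
    then show ?thesis
      using d by simp
  qed
  have "(1 - ?q) * L I ?T \<le> (1 - ?q) * (2 * ?x)" "0 \<le> (1 - ?q) * L I ?T" "0 \<le> 2 * ?x * ?q"
    using d IH(1) le by (auto intro!: mult_left_mono)
  then show ?case
    using Suc.prems(2) IH(1) le by (auto simp: L_Suc[of S k] algebra_simps)
qed

lemma L_mono:
  assumes "k \<le> num I" "S \<subseteq> T" "T \<subseteq> {1..k}"
  shows "L I S \<le> L I T"
  using assms
proof (induction k arbitrary: S T)
  case 0
  then show ?case by simp
next
  case (Suc k)
  let ?x = "pos I (Suc k)" and ?q = "prob I (Suc k)"
  let ?S = "S \<inter> {1..k}" and ?T = "T \<inter> {1..k}"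
  have d: "0 < ?x" "0 < ?q" "?q \<le> 1"
    using customer_data[of "Suc k"] Suc.prems by auto
  have IH: "L I ?S \<le> L I ?T"
    using Suc.prems by (intro Suc.IH) auto
  have "L I ?T \<le> 2 * ?x"
    using L_bounds[of "Suc k" ?T] Suc.prems by auto
  then have "?q * L I ?T \<le> ?q * (2 * ?x)" "(1 - ?q) * L I ?S \<le> (1 - ?q) * L I ?T"
    using d IH by (auto intro!: mult_left_mono)
  then show ?case
    using Suc.prems IH L_Suc[of S k I] L_Suc[of T k I] by (auto simp: algebra_simps)
qed

text \<open>In the induction step the inequality for \<open>{1..k}\<close> is multiplied by \<open>1 - \<pi>\<close>. If exactly
  one of the two sets contains the new customer, the remaining terms have weight \<open>\<pi>\<close> and are
  compared by monotonicity.\<close>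

lemma L_submodular:
  assumes "k \<le> num I" "S \<subseteq> {1..k}" "T \<subseteq> {1..k}"
  shows "L I (S \<union> T) + L I (S \<inter> T) \<le> L I S + L I T"
  using assms
proof (induction k arbitrary: S T)
  case 0
  then show ?case by simp
next
  case (Suc k)
  let ?q = "prob I (Suc k)"
  let ?S = "S \<inter> {1..k}" and ?T = "T \<inter> {1..k}"
  have d: "0 < ?q" "?q \<le> 1"
    using customer_data[of "Suc k"] Suc.prems by auto
  have IH: "L I (?S \<union> ?T) + L I (?S \<inter> ?T) \<le> L I ?S + L I ?T"
    using Suc.prems by (intro Suc.IH) auto
  have split: "(S \<union> T) \<inter> {1..k} = ?S \<union> ?T" "(S \<inter> T) \<inter> {1..k} = ?S \<inter> ?T"
    by auto
  have "(1 - ?q) * (L I (?S \<union> ?T) + L I (?S \<inter> ?T)) \<le> (1 - ?q) * (L I ?S + L I ?T)"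
    using d IH by (intro mult_left_mono) auto
  moreover have "L I (?S \<inter> ?T) \<le> L I ?S" "L I (?S \<inter> ?T) \<le> L I ?T"
    using Suc.prems by (auto intro!: L_mono[of k])
  then have "?q * L I (?S \<inter> ?T) \<le> ?q * L I ?S" "?q * L I (?S \<inter> ?T) \<le> ?q * L I ?T"
    using d by auto
  moreover have "S \<inter> T \<subseteq> {1..Suc k}"
    using Suc.prems by auto
  ultimately show ?case
    using Suc.prems IH L_Suc[of S k I] L_Suc[of T k I] L_Suc[of "S \<union> T" k I] L_Suc[of "S \<inter> T" k I]
    unfolding split by (auto simp: algebra_simps)
qed

lemma L_pos:
  assumes "S \<subseteq> {1..num I}" "S \<noteq> {}"
  shows "0 < L I S"
proof -
  obtain j where j: "j \<in> S"
    using assms by auto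
  have "L I {j} = 2 * pos I j * prob I j"
    by (auto simp: L_def intro!: prod.neutral)
  moreover have "\<dots> > 0"
    using customer_data[of j] assms j by auto
  moreover have "L I {j} \<le> L I S"
    using j assms by (intro L_mono[of "num I"]) auto
  ultimately show ?thesis
    by simp
qed

section \<open>Nesting of optimal sets\<close>

lemma R_strict_mono:
  assumes "S \<subset> T" "T \<subseteq> {1..num I}"
  shows "R I S < R I T"
proof -
  obtain j where j: "j \<in> T - S"
    using assms by auto
  have "0 < prob I i * prize I i" if "i \<in> T" for i
    using customer_data[of i] that assms by auto
  then show ?thesis
    unfolding R_def using assms j finite_subset[OF assms(2)]
    by (intro sum_strict_mono2[of _ _ j]) (auto simp: less_imp_le)
qed

text \<open>Let \<open>\<Delta>R\<close> and \<open>\<Delta>L\<close> be the differences between \<open>T\<close> and \<open>S \<inter> T\<close>. Optimality of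
  \<open>S\<close> against \<open>S \<union> T\<close> gives, by supermodularity, \<open>\<Delta>R \<le> c \<Delta>L\<close>, and optimality of \<open>T\<close> against
  \<open>S \<inter> T\<close> gives \<open>d \<Delta>L \<le> \<Delta>R\<close>. Since \<open>\<Delta>R > 0\<close> unless \<open>T \<subseteq> S\<close>, this contradicts \<open>c < d\<close>.\<close>

lemma optimal_antimono:
  assumes k: "k \<le> num I" and "0 \<le> c" "c < d"
    and S: "optimal I {1..k} S c" and T: "optimal I {1..k} T d"
  shows "T \<subseteq> S"
proof (rule ccontr)
  assume "\<not> T \<subseteq> S"
  then have strict: "S \<inter> T \<subset> T"
    by auto
  have sub: "S \<subseteq> {1..k}" "T \<subseteq> {1..k}"
    using S T by (auto simp: optimal_def)
  have disj: "R I (S \<union> T) + R I (S \<inter> T) = R I S + R I T"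
    unfolding R_def by (intro sum.union_inter finite_subset[OF sub(1)] finite_subset[OF sub(2)]) simp_all
  have "G I (S \<union> T) c \<le> G I S c" "G I (S \<inter> T) d \<le> G I T d"
    using S T sub by (auto simp: optimal_iff le_infI1)
  moreover have "c * (L I (S \<union> T) + L I (S \<inter> T)) \<le> c * (L I S + L I T)"
    using k sub \<open>0 \<le> c\<close> by (intro mult_left_mono L_submodular[of k]) auto
  ultimately have R_le: "R I T - R I (S \<inter> T) \<le> c * (L I T - L I (S \<inter> T))"
    and R_ge: "d * (L I T - L I (S \<inter> T)) \<le> R I T - R I (S \<inter> T)"
    using disj by (simp_all add: G_def algebra_simps)
  moreover have "R I (S \<inter> T) < R I T"
    using strict sub k by (intro R_strict_mono) auto
  ultimately have "0 < c * (L I T - L I (S \<inter> T))"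
    by linarith
  then have "0 < L I T - L I (S \<inter> T)"
    using \<open>0 \<le> c\<close> by (simp add: zero_less_mult_iff)
  then have "c * (L I T - L I (S \<inter> T)) < d * (L I T - L I (S \<inter> T))"
    using \<open>c < d\<close> by (rule mult_strict_right_mono[rotated])
  then show False
    using R_le R_ge by linarith
qed

text \<open>Nesting is applied in both directions, with the roles of \<open>S\<close> and \<open>T\<close> exchanged.\<close>

lemma optimal_unique:
  assumes "k \<le> num I" "0 \<le> c" "c < d"
    and "optimal I {1..k} S c" "optimal I {1..k} S d" "optimal I {1..k} T c" "optimal I {1..k} T d"
  shows "S = T"
  using assms optimal_antimono[of k c d] by blast

lemma optimal_zero_iff:
  assumes "k \<le> num I"
  shows "optimal I {1..k} S 0 \<longleftrightarrow> S = {1..k}"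
proof
  assume "optimal I {1..k} S 0"
  then have "S \<subseteq> {1..k}" "R I {1..k} \<le> R I S"
    by (auto simp: optimal_iff G_def)
  then show "S = {1..k}"
    using R_strict_mono[of S "{1..k}"] assms by fastforce
next
  assume "S = {1..k}"
  moreover have "R I T \<le> R I {1..k}" if "T \<subseteq> {1..k}" for T
  proof (cases "T = {1..k}")
    case False
    then show ?thesis
      using R_strict_mono[of T "{1..k}"] assms that by (auto simp: psubset_eq)
  qed simp
  ultimately show "optimal I {1..k} S 0"
    by (simp add: optimal_iff G_def)
qed

end

section \<open>Inserting a line into an envelope\<close>

definition height :: "line \<Rightarrow> real \<Rightarrow> real" where
  "height s c = rvn s - c * dst s"

text \<open>Continuity of affine functions, for intervals whose bounds may be infinite. It transfers
  comparisons to the endpoints of an interval, in particular to \<open>c = 0\<close>.\<close>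

lemma height_le_closure:
  fixes u w :: ereal
  assumes le: "\<And>c. u < ereal c \<Longrightarrow> ereal c < w \<Longrightarrow> height e c \<le> height h c"
    and "u < w" "u \<le> ereal x" "ereal x \<le> w"
  shows "height e x \<le> height h x"
proof (rule ccontr)
  define \<phi> where "\<phi> c = height h c - height e c" for c
  assume "\<not> height e x \<le> height h x"
  then have neg: "\<phi> x < 0"
    by (simp add: \<phi>_def)
  obtain m where m: "u < ereal m" "ereal m < w"
    using ereal_dense2[OF \<open>u < w\<close>] by auto
  have nonneg: "0 \<le> \<phi> m"
    using le[OF m] by (simp add: \<phi>_def)
  \<comment> \<open>The point \<open>y\<close> on the segment from \<open>x\<close> to \<open>m\<close> where \<open>\<phi>\<close> has half its value at \<open>x\<close>: it lies
    strictly between \<open>u\<close> and \<open>w\<close>, even if \<open>x\<close> is an endpoint.\<close>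
  define t where "t = - \<phi> x / (2 * (\<phi> m - \<phi> x))"
  have "0 < 2 * (\<phi> m - \<phi> x)" "- \<phi> x < 2 * (\<phi> m - \<phi> x)"
    using neg nonneg by simp_all
  then have t: "0 < t" "t < 1"
    unfolding t_def using neg by (subst pos_less_divide_eq pos_divide_less_eq; simp)+
  define y where "y = x + t * (m - x)"
  have "\<phi> y = \<phi> x + t * (\<phi> m - \<phi> x)"
    by (simp add: \<phi>_def height_def y_def algebra_simps)
  also have "\<dots> = \<phi> x / 2"
    using neg nonneg by (simp add: t_def field_simps)
  finally have "\<phi> y < 0"
    using neg by simp
  moreover have "u < ereal y \<and> ereal y < w"
  proof (cases "x < m")
    case True
    have "0 < t * (m - x)" "0 < (1 - t) * (m - x)"
      using t True by simp_all
    then have "x < y" "y < m"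
      by (simp_all add: y_def algebra_simps)
    then show ?thesis
      using m assms(3) by (meson ereal_less(1) le_less_trans less_trans less_ereal.simps(1))
  next
    case False
    then have "0 < t * (x - m)" "0 < (1 - t) * (x - m)"
      using t neg nonneg by (cases "x = m"; simp)+
    then have "y < x" "m < y"
      by (simp_all add: y_def algebra_simps)
    then show ?thesis
      using m assms(4) by (meson less_le_trans less_trans less_ereal.simps(1))
  qed
  ultimately show False
    using le[of y] by (simp add: \<phi>_def)
qed


lemma height_diff: "height e d - height f d = (height e c - height f c) + (c - d) * (dst e - dst f)"
  by (simp add: height_def algebra_simps)

lemma height_le_before:
  assumes "dst f \<le> dst e" "height f c \<le> height e c" "d \<le> c"
  shows "height f d \<le> height e d"
  using height_diff[of e d f c] mult_nonneg_nonneg[of "c - d" "dst e - dst f"] assms by linarith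

lemma height_less_before:
  assumes "dst f < dst e" "height f c \<le> height e c" "d < c"
  shows "height f d < height e d"
  using height_diff[of e d f c] mult_pos_pos[of "c - d" "dst e - dst f"] assms by linarith

lemma height_le_after:
  assumes "dst e \<le> dst f" "height f c \<le> height e c" "c \<le> d"
  shows "height f d \<le> height e d"
  using height_diff[of e d f c] mult_nonpos_nonpos[of "c - d" "dst e - dst f"] assms by linarith

lemma height_less_after:
  assumes "dst e < dst f" "height f c \<le> height e c" "c < d"
  shows "height f d < height e d"
  using height_diff[of e d f c] mult_neg_neg[of "c - d" "dst e - dst f"] assms by linarith

lemma height_less_between:
  assumes "height e c \<le> height h c" "height e m < height h m" "c < x \<and> x < m \<or> m < x \<and> x < c"
  shows "height e x < height h x"
proof (rule ccontr)
  assume "\<not> height e x < height h x"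
  then have "height h x \<le> height e x"
    by simp
  then show False
    using assms height_le_after[of e h x m] height_less_before[of h e x c]
      height_le_before[of h e x m] height_less_after[of e h x c]
    by (cases "dst e \<le> dst h"; cases "dst h \<le> dst e") auto
qed

text \<open>The invariant of the algorithm: \<open>D\<close> describes the function \<open>F\<close>. It requires that each
  interval be exactly the set of costs where the line attains \<open>F\<close>; that consecutive intervals
  share an endpoint then follows from the covering condition and need not be maintained.
  Only \<open>c > 0\<close> is considered: at \<open>c = 0\<close> a line may attain \<open>F\<close> without attaining it
  anywhere else, and then its interval is empty or the point \<open>0\<close> and the entry is deleted.\<close>

definition envelope :: "(real \<Rightarrow> real) \<Rightarrow> entry list \<Rightarrow> bool" where
  "envelope F D \<longleftrightarrow>
     sorted_wrt (\<lambda>x y. dst (fst y) < dst (fst x)) D \<and>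
     (\<forall>(e, a, b)\<in>set D. 0 \<le> a \<and> a < b \<and>
        (\<forall>c>0. height e c \<le> F c \<and> (a \<le> ereal c \<and> ereal c \<le> b \<longleftrightarrow> height e c = F c))) \<and>
     (\<forall>c>0. \<exists>(e, a, b)\<in>set D. a \<le> ereal c \<and> ereal c \<le> b)"

lemma envelope_cong: "(\<And>c. 0 < c \<Longrightarrow> F c = F' c) \<Longrightarrow> envelope F D \<longleftrightarrow> envelope F' D"
  by (simp add: envelope_def cong: conj_cong)

lemma envelope_entry:
  assumes "envelope F D" "(e, a, b) \<in> set D"
  shows "0 \<le> a" "a < b" "0 < c \<Longrightarrow> height e c \<le> F c"
    "0 < c \<Longrightarrow> a \<le> ereal c \<and> ereal c \<le> b \<longleftrightarrow> height e c = F c"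
  using assms by (auto simp: envelope_def)

lemma envelope_cover:
  assumes "envelope F D" "0 < c"
  obtains e a b where "(e, a, b) \<in> set D" "a \<le> ereal c" "ereal c \<le> b" "height e c = F c"
  using assms by (fastforce simp: envelope_def)

lemma timed_simps [simp]:
  "val (return x) = x" "steps (return x) = 0"
  "val (elem x) = x" "steps (elem x) = 1"
  "val (tick m) = val m" "steps (tick m) = steps m + 1"
  "val (bind_timed m f) = val (f (val m))"
  "steps (bind_timed m f) = steps m + steps (f (val m))"
  by (simp_all add: return_def elem_def tick_def bind_timed_def)

lemma beats_iff:
  assumes "0 < c"
  shows "fst (val (beats h e)) < ereal c \<and> ereal c < snd (val (beats h e)) \<longleftrightarrow>
    height e c < height h c"
proof -
  consider "dst h < dst e" | "dst e < dst h" | "dst e = dst h"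
    by linarith
  then show ?thesis
  proof cases
    case 1
    then show ?thesis
      by (simp add: beats_def height_def pos_divide_less_eq algebra_simps)
  next
    case 2
    then show ?thesis
      using assms by (simp add: beats_def height_def pos_less_divide_eq algebra_simps)
  next
    case 3
    then show ?thesis
      using assms by (simp add: beats_def height_def)
  qed
qed

lemma window_iff:
  assumes "0 < c"
  shows "fst (val (window h D)) < ereal c \<and> ereal c < snd (val (window h D)) \<longleftrightarrow>
    (\<forall>x\<in>set D. height (fst x) c < height h c)"
proof (induction D)
  case Nil
  then show ?case
    using assms by simp
next
  case (Cons x D)
  obtain e a b where x: "x = (e, a, b)"
    by (cases x)
  show ?case
    using Cons.IH beats_iff[OF assms, of h e] by (auto simp: x split_beta)
qed

lemma window_nonneg: "0 \<le> fst (val (window h D))"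
  by (induction D) (auto simp: split_beta le_max_iff_disj)

lemma set_cut_right:
  "set (val (cut_right w D)) = {(e, max a w, b) | e a b. (e, a, b) \<in> set D \<and> max a w < b}"
proof (induction D)
  case Nil
  then show ?case by simp
next
  case (Cons x D)
  then show ?case
    by (cases x) (auto split: if_splits)
qed

lemma sorted_cut_right:
  "sorted_wrt (\<lambda>x y. dst (fst y) < dst (fst x)) D \<Longrightarrow>
   sorted_wrt (\<lambda>x y. dst (fst y) < dst (fst x)) (val (cut_right w D))"
  by (induction D) (fastforce simp: set_cut_right)+

lemma set_place:
  assumes "sorted_wrt (\<lambda>x y. dst (fst y) < dst (fst x)) D"
  shows "set (val (place h u w D)) = insert (h, u, w)
     ({(e, a, min b u) | e a b. (e, a, b) \<in> set D \<and> dst h < dst e \<and> a < min b u} \<union>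
      {(e, max a w, b) | e a b. (e, a, b) \<in> set D \<and> dst e \<le> dst h \<and> max a w < b})"
  using assms
proof (induction D)
  case Nil
  then show ?case by simp
next
  case (Cons x D)
  obtain e a b where x: "x = (e, a, b)"
    by (cases x)
  show ?case
  proof (cases "dst h < dst e")
    case True
    then show ?thesis
      using Cons by (auto simp: x)
  next
    case False
    then have "\<forall>y\<in>set (x # D). dst (fst y) \<le> dst h"
      using Cons.prems by (force simp: x)
    then show ?thesis
      using False unfolding x
      by (simp add: set_cut_right del: cut_right.simps) fastforce
  qed
qed

text \<open>The new line is put in front of the first entry that is not steeper, so the order stays strict
  only if no parallel entry survives the cut; this is the second assumption.\<close>

lemma sorted_place:
  assumes "sorted_wrt (\<lambda>x y. dst (fst y) < dst (fst x)) D"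
    and "\<And>e a b. (e, a, b) \<in> set D \<Longrightarrow> dst e = dst h \<Longrightarrow> b \<le> max a w"
  shows "sorted_wrt (\<lambda>x y. dst (fst y) < dst (fst x)) (val (place h u w D))"
  using assms
proof (induction D)
  case Nil
  then show ?case by simp
next
  case (Cons x D)
  obtain e a b where x: "x = (e, a, b)"
    by (cases x)
  show ?case
  proof (cases "dst h < dst e")
    case True
    moreover have "sorted_wrt (\<lambda>x y. dst (fst y) < dst (fst x)) (val (place h u w D))"
      using Cons.prems by (intro Cons.IH) auto
    moreover have "dst (fst y) < dst e" if "y \<in> set (val (place h u w D))" for y
      using that True Cons.prems(1) by (force simp: x set_place)
    ultimately show ?thesis
      by (simp add: x)
  next
    case False
    have "dst (fst y) < dst h" if y: "y \<in> set (val (cut_right w (x # D)))" for y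
    proof -
      obtain f a' b' where f: "(f, a', b') \<in> set (x # D)" "max a' w < b'" "y = (f, max a' w, b')"
        using y unfolding set_cut_right by blast
      then have "dst f \<le> dst h"
        using False Cons.prems(1) by (force simp: x)
      moreover have "dst f \<noteq> dst h"
        using Cons.prems(2)[OF f(1)] f(2) by (meson leD)
      ultimately show ?thesis
        by (simp add: f)
    qed
    then show ?thesis
      using False sorted_cut_right[OF Cons.prems(1), of w] unfolding x
      by (simp del: cut_right.simps)
  qed
qed

text \<open>The set of costs where \<open>h\<close> is above the envelope is the open interval \<open>(u, w)\<close>. A steeper
  line that loses to \<open>h\<close> at some cost also loses to \<open>h\<close> at every larger one, so of its interval
  exactly the part up to \<open>u\<close> survives; symmetrically, of the interval of a line that is not steeper
  the part from \<open>w\<close> on survives. An entry is deleted only if at most one point is left, and such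
  a point lies in the interval \<open>[u, w]\<close> of \<open>h\<close>, so nothing becomes uncovered.\<close>

lemma envelope_insert:
  assumes env: "envelope F D"
  shows "envelope (\<lambda>c. max (F c) (height h c)) (val (insert_line h D))"
proof -
  obtain u w where uw: "val (window h D) = (u, w)"
    by fastforce
  have u: "0 \<le> u"
    using window_nonneg[of h D] by (simp add: uw)
  have window: "u < ereal c \<and> ereal c < w \<longleftrightarrow> (\<forall>x\<in>set D. height (fst x) c < height h c)"
    if "0 < c" for c
    using window_iff[OF that, of h D] by (simp add: uw)
  have above: "u < ereal c \<and> ereal c < w \<longleftrightarrow> F c < height h c" if "0 < c" for c
    unfolding window[OF that] using envelope_entry(3)[OF env _ that] envelope_cover[OF env that]
    by (smt (verit, ccfv_SIG) fst_conv prod.collapse)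
  show ?thesis
  proof (cases "u < w")
    case False
    then have "height h c \<le> F c" if "0 < c" for c
      using above[OF that] by (auto simp: not_less)
    then have "envelope (\<lambda>c. max (F c) (height h c)) D"
      using env by (subst envelope_cong[of _ F]) (auto simp: max_def intro: antisym)
    then show ?thesis
      using False by (simp add: insert_line_def uw)
  next
    case True
    have steeper: "a \<le> ereal c \<and> ereal c \<le> min b u \<longleftrightarrow> height e c = max (F c) (height h c)"
      if e: "(e, a, b) \<in> set D" "dst h < dst e" and c: "0 < c" for e a b c
    proof
      assume "a \<le> ereal c \<and> ereal c \<le> min b u"
      then show "height e c = max (F c) (height h c)"
        using envelope_entry(4)[OF env e(1) c] above[OF c] by auto
    next
      assume "height e c = max (F c) (height h c)"
      then have eq: "height e c = F c" and le: "height h c \<le> height e c"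
        using envelope_entry(3)[OF env e(1) c] by auto
      have "ereal c \<le> u"
      proof (rule ccontr)
        assume "\<not> ereal c \<le> u"
        then have "u < min (ereal c) w"
          using True by simp
        then obtain m where m: "u < ereal m" "ereal m < min (ereal c) w"
          using ereal_dense2 by blast
        then have "0 < m" "m \<le> c"
          using u by (auto dest: le_less_trans)
        then have "height h m \<le> F m"
          using height_le_before[of h e c m] e(2) le envelope_entry(3)[OF env e(1), of m] by linarith
        then show False
          using above[OF \<open>0 < m\<close>] m by simp
      qed
      then show "a \<le> ereal c \<and> ereal c \<le> min b u"
        using eq envelope_entry(4)[OF env e(1) c] by simp
    qed
    have flatter: "max a w \<le> ereal c \<and> ereal c \<le> b \<longleftrightarrow> height e c = max (F c) (height h c)"
      if e: "(e, a, b) \<in> set D" "dst e \<le> dst h" and c: "0 < c" for e a b c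
    proof
      assume "max a w \<le> ereal c \<and> ereal c \<le> b"
      then show "height e c = max (F c) (height h c)"
        using envelope_entry(4)[OF env e(1) c] above[OF c] by auto
    next
      assume "height e c = max (F c) (height h c)"
      then have eq: "height e c = F c" and le: "height h c \<le> height e c"
        using envelope_entry(3)[OF env e(1) c] by auto
      have "w \<le> ereal c"
      proof (rule ccontr)
        assume "\<not> w \<le> ereal c"
        then have "max u (ereal c) < w"
          using True by simp
        then obtain m where m: "max u (ereal c) < ereal m" "ereal m < w"
          using ereal_dense2 by blast
        then have "0 < m" "c \<le> m"
          using c by auto
        then have "height h m \<le> F m"
          using height_le_after[of e h c m] e(2) le envelope_entry(3)[OF env e(1), of m] by linarith
        then show False
          using above[OF \<open>0 < m\<close>] m by simp
      qed
      then show "max a w \<le> ereal c \<and> ereal c \<le> b"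
        using eq envelope_entry(4)[OF env e(1) c] by simp
    qed
    have new: "u \<le> ereal c \<and> ereal c \<le> w \<longleftrightarrow> height h c = max (F c) (height h c)"
      if c: "0 < c" for c
    proof
      assume uw_c: "u \<le> ereal c \<and> ereal c \<le> w"
      obtain e a b where e: "(e, a, b) \<in> set D" "height e c = F c"
        using envelope_cover[OF env c] by metis
      have "height e d \<le> height h d" if "u < ereal d" "ereal d < w" for d
      proof -
        have "0 < d"
          using u that by (auto dest: le_less_trans)
        then show ?thesis
          using window[of d] that e(1) by force
      qed
      then have "height e c \<le> height h c"
        using height_le_closure[of u w e h c] True uw_c by blast
      then show "height h c = max (F c) (height h c)"
        using e(2) by simp
    next
      assume "height h c = max (F c) (height h c)"
      then have le: "height (fst x) c \<le> height h c" if "x \<in> set D" for x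
        using envelope_entry(3)[OF env _ c, of "fst x" "fst (snd x)" "snd (snd x)"] that by simp
      obtain m where m: "u < ereal m" "ereal m < w"
        using ereal_dense2[OF True] by auto
      then have "0 < m"
        using u by (auto dest: le_less_trans)
      then have strict: "height (fst x) m < height h m" if "x \<in> set D" for x
        using window[of m] m that by simp
      have between: "u < ereal d \<and> ereal d < w" if "c < d \<and> d < m \<or> m < d \<and> d < c" for d
      proof -
        have "0 < d"
          using that c \<open>0 < m\<close> by auto
        then show ?thesis
          using window[of d] height_less_between[OF le strict that] by simp
      qed
      show "u \<le> ereal c \<and> ereal c \<le> w"
      proof (intro conjI; rule ccontr)
        assume "\<not> u \<le> ereal c"
        then obtain d where d: "ereal c < ereal d" "ereal d < u"
          using ereal_dense2[of "ereal c" u] by (meson not_le)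
        then have "ereal d < ereal m"
          using m by (metis less_trans)
        then show False
          using between[of d] d by auto
      next
        assume "\<not> ereal c \<le> w"
        then obtain d where d: "w < ereal d" "ereal d < ereal c"
          using ereal_dense2[of w "ereal c"] by (meson not_le)
        then have "ereal m < ereal d"
          using m by (metis less_trans)
        then show False
          using between[of d] d by auto
      qed
    qed
    let ?D = "val (place h u w D)"
    have sorted: "sorted_wrt (\<lambda>x y. dst (fst y) < dst (fst x)) D"
      using env by (simp add: envelope_def)
    \<comment> \<open>A line parallel to \<open>h\<close> that still attains the maximum at one cost would be nowhere
      below \<open>h\<close>, although \<open>h\<close> is above the envelope on \<open>(u, w)\<close>.\<close>
    have parallel: "b \<le> max a w" if e: "(e, a, b) \<in> set D" "dst e = dst h" for e a b
    proof (rule ccontr)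
      assume "\<not> b \<le> max a w"
      then obtain c where c: "max a w < ereal c" "ereal c < b"
        using ereal_dense2[of "max a w" b] by (meson not_le)
      have "0 < c"
        using envelope_entry(1)[OF env e(1)] c(1) by (auto dest: le_less_trans)
      have "height h c \<le> height e c"
        using flatter[OF e(1) _ \<open>0 < c\<close>] c e(2) by auto
      obtain m where m: "u < ereal m" "ereal m < w"
        using ereal_dense2[OF True] by auto
      then have "0 < m"
        using u by (auto dest: le_less_trans)
      have "height h m \<le> F m"
        using \<open>height h c \<le> height e c\<close> e(2) envelope_entry(3)[OF env e(1) \<open>0 < m\<close>]
        by (simp add: height_def)
      then show False
        using above[OF \<open>0 < m\<close>] m by simp
    qed
    have "envelope (\<lambda>c. max (F c) (height h c)) ?D"
      unfolding envelope_def
    proof (intro conjI)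
      show "sorted_wrt (\<lambda>x y. dst (fst y) < dst (fst x)) ?D"
        using sorted parallel by (rule sorted_place)
      show "\<forall>(e, a, b)\<in>set ?D. 0 \<le> a \<and> a < b \<and>
        (\<forall>c>0. height e c \<le> max (F c) (height h c) \<and>
           (a \<le> ereal c \<and> ereal c \<le> b \<longleftrightarrow> height e c = max (F c) (height h c)))"
      proof (intro ballI, clarify)
        fix e a b
        assume "(e, a, b) \<in> set ?D"
        then consider "e = h" "a = u" "b = w"
          | b' where "(e, a, b') \<in> set D" "dst h < dst e" "b = min b' u" "a < b"
          | a' where "(e, a', b) \<in> set D" "dst e \<le> dst h" "a = max a' w" "a < b"
          unfolding set_place[OF sorted] by blast
        then show "0 \<le> a \<and> a < b \<and> (\<forall>c>0. height e c \<le> max (F c) (height h c) \<and>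
           (a \<le> ereal c \<and> ereal c \<le> b \<longleftrightarrow> height e c = max (F c) (height h c)))"
        proof cases
          case 1
          then show ?thesis
            using u \<open>u < w\<close> new by simp
        next
          case 2
          then show ?thesis
            using steeper[OF 2(1,2)] envelope_entry(1,3)[OF env 2(1)]
            by (simp add: le_max_iff_disj del: min.bounded_iff)
        next
          case 3
          then show ?thesis
            using flatter[OF 3(1,2)] envelope_entry(1,3)[OF env 3(1)]
            by (simp add: le_max_iff_disj del: max.bounded_iff)
        qed
      qed
      show "\<forall>c>0. \<exists>(e, a, b)\<in>set ?D. a \<le> ereal c \<and> ereal c \<le> b"
      proof (intro allI impI)
        fix c :: real
        assume c: "0 < c"
        obtain e a b where e: "(e, a, b) \<in> set D" "a \<le> ereal c" "ereal c \<le> b" "height e c = F c"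
          using envelope_cover[OF env c] .
        show "\<exists>(e, a, b)\<in>set ?D. a \<le> ereal c \<and> ereal c \<le> b"
        proof (cases "u \<le> ereal c \<and> ereal c \<le> w")
          case True
          then show ?thesis
            by (auto simp: set_place[OF sorted])
        next
          case False
          then have max: "height e c = max (F c) (height h c)"
            using above[OF c] e(4) by auto
          show ?thesis
          proof (cases "dst h < dst e")
            case True
            then have "a \<le> ereal c \<and> ereal c \<le> min b u"
              using steeper[OF e(1) _ c] max by simp
            moreover have "ereal c < u"
              using calculation False \<open>u < w\<close> by auto
            ultimately have "a < min b u"
              using envelope_entry(2)[OF env e(1)] by auto
            then have "(e, a, min b u) \<in> set ?D"
              using e(1) True by (auto simp: set_place[OF sorted])
            then show ?thesis
              using \<open>a \<le> ereal c \<and> ereal c \<le> min b u\<close> by blast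
          next
            case slope: False
            then have "max a w \<le> ereal c \<and> ereal c \<le> b"
              using flatter[OF e(1) _ c] max by simp
            moreover have "w < ereal c"
              using calculation False \<open>u < w\<close> by auto
            ultimately have "max a w < b"
              using envelope_entry(2)[OF env e(1)] by auto
            then have "(e, max a w, b) \<in> set ?D"
              using e(1) slope by (auto simp: set_place[OF sorted])
            then show ?thesis
              using \<open>max a w \<le> ereal c \<and> ereal c \<le> b\<close> by blast
          qed
        qed
      qed
    qed
    then show ?thesis
      using True by (simp add: insert_line_def uw)
  qed
qed


lemma envelope_joint_sort_filter:
  assumes "envelope F D"
  shows "envelope (\<lambda>c. Max (insert (F c) ((\<lambda>h. height h c) ` set E))) (val (joint_sort_filter D E))"
  using assms
proof (induction E arbitrary: F D)
  case Nil
  then show ?case by simp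
next
  case (Cons h E)
  have "Max (insert (max (F c) (height h c)) X) = Max (insert (F c) (insert (height h c) X))"
    if "finite X" for c X
    using that by (cases "X = {}") (simp_all add: max.assoc)
  then show ?case
    using Cons.IH[OF envelope_insert[OF Cons.prems, of h]] by simp
qed

section \<open>The shape of an envelope\<close>

abbreviation "lower x \<equiv> fst (snd x)"
abbreviation "upper x \<equiv> snd (snd x)"

lemma envelope_nth:
  assumes "envelope F D" "i < length D"
  shows "0 \<le> lower (D ! i)" "lower (D ! i) < upper (D ! i)"
    "0 < c \<Longrightarrow> height (fst (D ! i)) c \<le> F c"
    "0 < c \<Longrightarrow> lower (D ! i) \<le> ereal c \<and> ereal c \<le> upper (D ! i) \<longleftrightarrow> height (fst (D ! i)) c = F c"
  using envelope_entry[OF assms(1), of "fst (D ! i)" "lower (D ! i)" "upper (D ! i)"] nth_mem[OF assms(2)]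
  by simp_all

lemma envelope_cover_nth:
  assumes "envelope F D" "0 < c"
  obtains i where "i < length D" "lower (D ! i) \<le> ereal c" "ereal c \<le> upper (D ! i)"
  using envelope_cover[OF assms] by (metis fst_conv in_set_conv_nth snd_conv)

lemma envelope_steeper:
  "envelope F D \<Longrightarrow> i < j \<Longrightarrow> j < length D \<Longrightarrow> dst (fst (D ! j)) < dst (fst (D ! i))"
  by (auto simp: envelope_def sorted_wrt_iff_nth_less)

text \<open>If the intervals overlapped in the wrong order, the flatter line \<open>j\<close> would attain \<open>F\<close> at some
  \<open>c\<close> and hence be strictly above line \<open>i\<close> at every later \<open>d\<close>, where \<open>i\<close> attains \<open>F\<close>.\<close>

lemma envelope_ordered:
  assumes env: "envelope F D" and ij: "i < j" "j < length D"
  shows "upper (D ! i) \<le> lower (D ! j)"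
proof (rule ccontr)
  let ?e = "fst (D ! i)" and ?f = "fst (D ! j)"
  note i = envelope_nth[OF env less_trans[OF ij]] and j = envelope_nth[OF env ij(2)]
  assume "\<not> upper (D ! i) \<le> lower (D ! j)"
  then have "lower (D ! j) < min (upper (D ! i)) (upper (D ! j))"
    using j(2) by simp
  then obtain c where c: "lower (D ! j) < ereal c" "ereal c < min (upper (D ! i)) (upper (D ! j))"
    using ereal_dense2 by blast
  then have "max (lower (D ! i)) (ereal c) < upper (D ! i)"
    using i(2) by simp
  then obtain d where d: "max (lower (D ! i)) (ereal c) < ereal d" "ereal d < upper (D ! i)"
    using ereal_dense2 by blast
  have pos: "0 < c" "c < d"
    using c d j(1) by (auto dest: le_less_trans)
  have "height ?e c \<le> height ?f c"
    using i(3)[OF pos(1)] j(4)[OF pos(1)] c by auto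
  then have "height ?e d < height ?f d"
    using envelope_steeper[OF env ij] pos by (intro height_less_after)
  then show False
    using i(4)[of d] j(3)[of d] pos d by auto
qed

text \<open>The remaining shape comes from covering: a cost below the first interval, above the last one or
  in a gap would have to belong to some other interval, which \<open>envelope_ordered\<close> excludes.\<close>

lemma envelope_first:
  assumes env: "envelope F D"
  shows "0 < length D" "lower (D ! 0) = 0"
proof -
  show len: "0 < length D"
    using envelope_cover_nth[OF env zero_less_one] by fastforce
  show "lower (D ! 0) = 0"
  proof (rule ccontr)
    assume "lower (D ! 0) \<noteq> 0"
    then have "0 < lower (D ! 0)"
      using envelope_nth(1)[OF env len] by simp
    then obtain c where c: "0 < ereal c" "ereal c < lower (D ! 0)"
      using ereal_dense2 by blast
    then obtain j where j: "j < length D" "lower (D ! j) \<le> ereal c"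
      using envelope_cover_nth[OF env, of c] by auto
    then show False
      using c envelope_ordered[OF env, of 0 j] envelope_nth(2)[OF env len] by (cases "j = 0") auto
  qed
qed

lemma envelope_last:
  assumes env: "envelope F D"
  shows "upper (D ! (length D - 1)) = \<infinity>"
proof (rule ccontr)
  let ?x = "D ! (length D - 1)"
  have len: "length D - 1 < length D"
    using envelope_first(1)[OF env] by simp
  note x = envelope_nth(1,2)[OF env len]
  assume "upper ?x \<noteq> \<infinity>"
  then have "upper ?x < \<infinity>"
    by simp
  then obtain c where c: "upper ?x < ereal c"
    using ereal_dense2 by blast
  then have "0 < ereal c"
    by (rule less_trans[OF le_less_trans[OF x]])
  then have "0 < c"
    by simp
  then obtain j where j: "j < length D" "ereal c \<le> upper (D ! j)"
    using envelope_cover_nth[OF env] by metis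
  have "upper (D ! j) \<le> upper ?x"
  proof (cases "j = length D - 1")
    case False
    then have "upper (D ! j) \<le> lower ?x"
      using j(1) by (intro envelope_ordered[OF env _ len]) simp
    then show ?thesis
      using x(2) by simp
  qed simp
  then show False
    using c j(2) by (metis leD order_trans)
qed

lemma envelope_adjacent:
  assumes env: "envelope F D" and i: "Suc i < length D"
  shows "upper (D ! i) = lower (D ! Suc i)"
proof (rule antisym)
  show "upper (D ! i) \<le> lower (D ! Suc i)"
    using envelope_ordered[OF env _ i] by simp
  show "lower (D ! Suc i) \<le> upper (D ! i)"
  proof (rule ccontr)
    assume "\<not> lower (D ! Suc i) \<le> upper (D ! i)"
    then obtain c where c: "upper (D ! i) < ereal c" "ereal c < lower (D ! Suc i)"
      using ereal_dense2 by (meson not_le)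
    have "0 < upper (D ! i)"
      using envelope_nth(1,2)[OF env Suc_lessD[OF i]] by (rule le_less_trans)
    then have "0 < ereal c"
      using c(1) by (rule less_trans)
    then have "0 < c"
      by simp
    then obtain j where j: "j < length D" "lower (D ! j) \<le> ereal c" "ereal c \<le> upper (D ! j)"
      using envelope_cover_nth[OF env] by metis
    show False
    proof (cases "j \<le> i")
      case True
      then have "upper (D ! j) \<le> upper (D ! i)"
        using envelope_ordered[OF env, of j i] envelope_nth(2)[OF env, of i] i by (cases "j = i") auto
      then show False
        using c(1) j(3) by auto
    next
      case False
      then have "lower (D ! Suc i) \<le> lower (D ! j)"
        using envelope_ordered[OF env, of "Suc i" j] envelope_nth(2)[OF env i] j(1)
        by (cases "j = Suc i") auto
      then show False
        using c(2) j(2) by auto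
    qed
  qed
qed

lemma lines_insert_line: "fst ` set (val (insert_line h D)) \<subseteq> insert h (fst ` set D)"
proof -
  have "fst ` set (val (place h u w D)) \<subseteq> insert h (fst ` set D)" for u w
  proof (induction D)
    case (Cons x D)
    obtain e a b where x: "x = (e, a, b)"
      by (cases x)
    show ?case
    proof (cases "dst h < dst e")
      case True
      then show ?thesis
        using Cons.IH by (auto simp: x)
    next
      case False
      have "fst ` set (val (cut_right w (x # D))) \<subseteq> fst ` set (x # D)"
        unfolding set_cut_right by force
      then show ?thesis
        using False by (auto simp: x simp del: cut_right.simps)
    qed
  qed simp
  then show ?thesis
    by (auto simp: insert_line_def split_beta)
qed

lemma lines_joint_sort_filter: "fst ` set (val (joint_sort_filter D E)) \<subseteq> fst ` set D \<union> set E"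
proof (induction E arbitrary: D)
  case (Cons h E)
  have "fst ` set (val (joint_sort_filter (val (insert_line h D)) E))
      \<subseteq> fst ` set (val (insert_line h D)) \<union> set E"
    by (rule Cons.IH)
  also have "\<dots> \<subseteq> insert h (fst ` set D) \<union> set E"
    by (rule Un_mono[OF lines_insert_line order_refl])
  finally show ?case
    by simp
qed simp

section \<open>The envelope computed by the loop\<close>

definition represents_subset :: "pptp \<Rightarrow> nat \<Rightarrow> line \<Rightarrow> bool" where
  "represents_subset I k s \<longleftrightarrow> set (members s) \<subseteq> {1..k} \<and>
     rvn s = R I (set (members s)) \<and> dst s = L I (set (members s))"

lemma height_represents_subset: "represents_subset I k s \<Longrightarrow> height s c = G I (set (members s)) c"
  by (simp add: represents_subset_def height_def G_def)

lemma insert_Suc: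
  assumes "T \<subseteq> {1..k}"
  shows "R I (insert (Suc k) T) = prob I (Suc k) * prize I (Suc k) + R I T"
    and "L I (insert (Suc k) T) = 2 * pos I (Suc k) * prob I (Suc k) + (1 - prob I (Suc k)) * L I T"
proof -
  have "Suc k \<notin> T" "finite T" "insert (Suc k) T \<inter> {1..k} = T" "insert (Suc k) T \<subseteq> {1..Suc k}"
    using assms finite_subset[OF assms] by auto
  then show "R I (insert (Suc k) T) = prob I (Suc k) * prize I (Suc k) + R I T"
    and "L I (insert (Suc k) T) = 2 * pos I (Suc k) * prob I (Suc k) + (1 - prob I (Suc k)) * L I T"
    using L_Suc[of "insert (Suc k) T" k I] by (simp_all add: R_def)
qed

lemma G_insert_Suc:
  assumes "T \<subseteq> {1..k}"
  shows "G I (insert (Suc k) T) c =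
    prob I (Suc k) * prize I (Suc k) - c * (2 * pos I (Suc k) * prob I (Suc k))
      + G I T (c * (1 - prob I (Suc k)))"
  by (simp add: G_def insert_Suc[OF assms] algebra_simps)

lemma extend_represents_subset:
  assumes "represents_subset I k s"
  shows "represents_subset I (Suc k) (val (extend I (Suc k) s))"
    and "members (val (extend I (Suc k) s)) = Suc k # members s"
proof -
  have "set (members s) \<subseteq> {1..k}"
    using assms by (simp add: represents_subset_def)
  then show "represents_subset I (Suc k) (val (extend I (Suc k) s))"
    using assms insert_Suc[of "set (members s)" k I]
    by (auto simp: represents_subset_def extend_def)
  show "members (val (extend I (Suc k) s)) = Suc k # members s"
    by (simp add: extend_def)
qed

lemma val_extend_all: "val (extend_all I k D) = map (\<lambda>x. val (extend I k (fst x))) D"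
  by (induction I k D rule: extend_all.induct) simp_all

text \<open>The case \<open>c = 0\<close>, where the invariant says nothing, is reached by continuity from the first
  interval. It is needed when the new customer is present with probability one: then every set is
  to be compared at cost \<open>0\<close>.\<close>

lemma envelope_dominates:
  assumes env: "envelope (PPTP I {1..k}) D" and T: "T \<subseteq> {1..k}" and c: "0 \<le> c"
  shows "\<exists>x\<in>set D. G I T c \<le> height (fst x) c"
proof (cases "c = 0")
  case False
  then obtain e a b where "(e, a, b) \<in> set D" "height e c = PPTP I {1..k} c"
    using envelope_cover[OF env, of c] c by (metis order_le_less)
  then show ?thesis
    using PPTP_ge[of "{1..k}" T I c] T by force
next
  case True
  let ?x = "D ! 0" and ?t = "Line [] (R I T) (L I T)"
  note x = envelope_first[OF env]
  have "height ?t d \<le> height (fst ?x) d" if "0 < ereal d" "ereal d < upper ?x" for d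
    using envelope_nth(4)[OF env x(1), of d] x(2) that less_imp_le[OF that(2)] PPTP_ge[of "{1..k}" T I d] T
    by (simp add: height_def G_def)
  moreover have "0 < upper ?x"
    using envelope_nth(2)[OF env x(1)] x(2) by simp
  ultimately have "height ?t 0 \<le> height (fst ?x) 0"
    by (rule height_le_closure) (use \<open>0 < upper ?x\<close> in \<open>simp_all add: less_imp_le flip: zero_ereal_def\<close>)
  then show ?thesis
    using nth_mem[OF x(1)] True by (auto simp: height_def G_def)
qed

text \<open>The lines of \<open>D\<close> with the new customer added dominate all sets that contain it, because
  \<open>G_insert_Suc\<close> reduces a comparison at \<open>c\<close> to one of the smaller sets at \<open>c (1 - \<pi>)\<close>.\<close>

lemma PPTP_Suc:
  assumes env: "envelope (PPTP I {1..k}) D"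
    and lines: "\<forall>x\<in>set D. represents_subset I k (fst x)"
    and c: "0 < c" and q: "prob I (Suc k) \<le> 1"
  shows "PPTP I {1..Suc k} c =
    Max (insert (PPTP I {1..k} c) ((\<lambda>h. height h c) ` set (val (extend_all I (Suc k) D))))"
    (is "_ = Max ?X")
proof (rule antisym)
  have height_extend: "height (val (extend I (Suc k) (fst x))) d = G I (insert (Suc k) (set (members (fst x)))) d"
    if "x \<in> set D" for x d
  proof -
    have "represents_subset I k (fst x)"
      using lines that by blast
    note extended = extend_represents_subset[OF this]
    show ?thesis
      unfolding height_represents_subset[OF extended(1)] extended(2) by simp
  qed
  have "G I S c \<le> Max ?X" if S: "S \<subseteq> {1..Suc k}" for S
  proof (cases "Suc k \<in> S")
    case False
    then have "S \<subseteq> {1..k}"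
      using S by (auto simp: le_Suc_eq)
    then have "G I S c \<le> PPTP I {1..k} c"
      by (simp add: PPTP_ge)
    also have "\<dots> \<le> Max ?X"
      by (intro Max_ge) auto
    finally show ?thesis .
  next
    case True
    define T where "T = S - {Suc k}"
    have T: "T \<subseteq> {1..k}" "S = insert (Suc k) T"
      using S True by (auto simp: T_def le_Suc_eq)
    obtain x where x: "x \<in> set D"
      "G I T (c * (1 - prob I (Suc k))) \<le> height (fst x) (c * (1 - prob I (Suc k)))"
      using envelope_dominates[OF env T(1), of "c * (1 - prob I (Suc k))"] c q by auto
    have rep: "represents_subset I k (fst x)"
      using lines x(1) by blast
    then have M: "set (members (fst x)) \<subseteq> {1..k}"
      by (simp add: represents_subset_def)
    have "G I S c \<le> height (val (extend I (Suc k) (fst x))) c"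
      using x(2) unfolding height_extend[OF x(1)] T(2) G_insert_Suc[OF T(1)] G_insert_Suc[OF M]
        height_represents_subset[OF rep] by linarith
    also have "\<dots> \<le> Max ?X"
      using x(1) by (intro Max_ge) (auto simp: val_extend_all)
    finally show ?thesis .
  qed
  then show "PPTP I {1..Suc k} c \<le> Max ?X"
    unfolding PPTP_def[of I "{1..Suc k}"] by (intro Max.boundedI) auto
  have "PPTP I {1..k} c \<le> PPTP I {1..Suc k} c"
    unfolding PPTP_def by (intro Max_mono image_mono Pow_mono) auto
  moreover have "height (val (extend I (Suc k) (fst x))) c \<le> PPTP I {1..Suc k} c" if "x \<in> set D" for x
    unfolding height_extend[OF that] using lines that
    by (intro PPTP_ge) (force simp: represents_subset_def)+
  ultimately show "Max ?X \<le> PPTP I {1..Suc k} c"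
    by (intro Max.boundedI) (auto simp: val_extend_all)
qed

lemma envelope_pptp_loop:
  assumes inst: "pptp_instance I" and "k \<le> num I"
  shows "envelope (PPTP I {1..k}) (val (pptp_loop I k)) \<and>
    (\<forall>x\<in>set (val (pptp_loop I k)). represents_subset I k (fst x))"
  using assms(2)
proof (induction k)
  case 0
  then show ?case
    by (simp add: envelope_def PPTP_def G_def height_def represents_subset_def)
next
  case (Suc k)
  let ?D = "val (pptp_loop I k)" and ?E = "val (extend_all I (Suc k) (val (pptp_loop I k)))"
  have IH: "envelope (PPTP I {1..k}) ?D" "\<forall>x\<in>set ?D. represents_subset I k (fst x)"
    using Suc by auto
  have q: "prob I (Suc k) \<le> 1"
    using customer_data(4)[OF inst, of "Suc k"] Suc.prems by auto
  have "PPTP I {1..Suc k} c = Max (insert (PPTP I {1..k} c) ((\<lambda>h. height h c) ` set ?E))"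
    if "0 < c" for c
    by (rule PPTP_Suc[OF IH that q])
  then have "envelope (PPTP I {1..Suc k}) (val (joint_sort_filter ?D ?E))"
    by (rule iffD2[OF envelope_cong envelope_joint_sort_filter[OF IH(1)]])
  moreover have "represents_subset I (Suc k) s" if s: "s \<in> fst ` set ?D \<union> set ?E" for s
  proof (cases "s \<in> set ?E")
    case True
    then show ?thesis
      using IH(2) extend_represents_subset(1)[of I k] unfolding val_extend_all by force
  next
    case False
    then have "represents_subset I k s"
      using s IH(2) by auto
    then show ?thesis
      by (auto simp: represents_subset_def)
  qed
  ultimately show ?case
    using subsetD[OF lines_joint_sort_filter imageI, of _ ?D ?E] unfolding pptp_loop.simps timed_simps
    by blast
qed


section \<open>From the envelope to the description\<close>

abbreviation customers :: "entry \<Rightarrow> nat set" where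
  "customers x \<equiv> set (members (fst x))"

context
  fixes I :: pptp and k :: nat and D :: "entry list"
  assumes inst: "pptp_instance I" and k: "k \<le> num I"
    and env: "envelope (PPTP I {1..k}) D"
    and lines: "\<forall>x\<in>set D. represents_subset I k (fst x)"
begin

lemma customers_subset: "i < length D \<Longrightarrow> customers (D ! i) \<subseteq> {1..k}"
  using lines nth_mem[of i D] by (auto simp: represents_subset_def)

lemma height_nth: "i < length D \<Longrightarrow> height (fst (D ! i)) c = G I (customers (D ! i)) c"
  using lines nth_mem[of i D] height_represents_subset by blast

lemma dst_nth: "i < length D \<Longrightarrow> dst (fst (D ! i)) = L I (customers (D ! i))"
  using lines nth_mem[of i D] by (simp add: represents_subset_def)

lemma optimal_nth:
  assumes "i < length D" "0 < c"
  shows "optimal I {1..k} (customers (D ! i)) c \<longleftrightarrow>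
    lower (D ! i) \<le> ereal c \<and> ereal c \<le> upper (D ! i)"
  using envelope_nth(4)[OF env assms] customers_subset[OF assms(1)]
  by (simp add: optimal_def height_nth[OF assms(1)])

lemma customers_nested:
  assumes "i < j" "j < length D"
  shows "customers (D ! j) \<subset> customers (D ! i)"
proof -
  have i: "i < length D"
    using assms by simp
  obtain c where c: "lower (D ! i) < ereal c" "ereal c < upper (D ! i)"
    using ereal_dense2[OF envelope_nth(2)[OF env i]] by auto
  obtain d where d: "lower (D ! j) < ereal d" "ereal d < upper (D ! j)"
    using ereal_dense2[OF envelope_nth(2)[OF env assms(2)]] by auto
  have "ereal c < ereal d"
    using c(2) envelope_ordered[OF env assms] d(1) by (meson less_le_trans less_trans)
  moreover have "0 < ereal c"
    using envelope_nth(1)[OF env i] c(1) by (rule le_less_trans)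
  ultimately have cd: "0 < c" "c < d"
    by simp_all
  have "customers (D ! j) \<subseteq> customers (D ! i)"
  proof (rule optimal_antimono[OF inst k _ cd(2)])
    show "optimal I {1..k} (customers (D ! i)) c"
      using optimal_nth[OF i cd(1)] c by (simp add: less_imp_le)
    show "optimal I {1..k} (customers (D ! j)) d"
      using optimal_nth[OF assms(2), of d] cd d by (simp add: less_imp_le)
  qed (use cd in simp)
  moreover have "customers (D ! j) \<noteq> customers (D ! i)"
    using envelope_steeper[OF env assms] dst_nth[OF i] dst_nth[OF assms(2)] by auto
  ultimately show ?thesis
    by blast
qed

lemma length_le: "length D \<le> k + 1"
proof -
  have "card (customers (D ! i)) + i \<le> k" if "i < length D" for i
    using that
  proof (induction i)
    case 0
    then show ?case
      using card_mono[OF _ customers_subset[OF 0]] by simp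
  next
    case (Suc i)
    then show ?case
      using psubset_card_mono[OF _ customers_nested[of i "Suc i"]] by fastforce
  qed
  from this[of "length D - 1"] show ?thesis
    by (cases "length D = 0") auto
qed

text \<open>The first set is optimal for small \<open>c > 0\<close>, hence by continuity for \<open>c = 0\<close>, where only the full
  set collects all prizes.\<close>

lemma customers_first: "customers (D ! 0) = {1..k}"
proof -
  note first = envelope_first[OF env]
  have up: "0 < upper (D ! 0)"
    using envelope_nth(2)[OF env first(1)] first(2) by simp
  let ?t = "Line [] (R I {1..k}) (L I {1..k})"
  have "height ?t c \<le> height (fst (D ! 0)) c" if "0 < ereal c" "ereal c < upper (D ! 0)" for c
  proof -
    have "height (fst (D ! 0)) c = PPTP I {1..k} c"
      using envelope_nth(4)[OF env first(1), of c] first(2) that by (simp add: less_imp_le)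
    then show ?thesis
      using PPTP_ge[of "{1..k}" "{1..k}" I c] by (simp add: height_def G_def)
  qed
  then have "height ?t 0 \<le> height (fst (D ! 0)) 0"
    using up by (rule height_le_closure) (use up in \<open>simp_all add: less_imp_le flip: zero_ereal_def\<close>)
  then have "R I {1..k} \<le> R I (customers (D ! 0))"
    using first(1) by (simp add: height_nth) (simp add: height_def G_def)
  then show ?thesis
    using R_strict_mono[OF inst, of "customers (D ! 0)" "{1..k}"] customers_subset[OF first(1)] k
    by (auto simp: psubset_eq)
qed

text \<open>The last set is optimal for arbitrarily large \<open>c\<close>, and a set with positive distance is not.\<close>

lemma customers_last: "customers (D ! (length D - 1)) = {}"
proof (rule ccontr)
  let ?x = "D ! (length D - 1)" and ?T = "customers (D ! (length D - 1))"
  assume "?T \<noteq> {}"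
  have len: "length D - 1 < length D"
    using envelope_first(1)[OF env] by simp
  have "0 < L I ?T"
    using customers_subset[OF len] k \<open>?T \<noteq> {}\<close> by (intro L_pos[OF inst]) auto
  obtain b where b: "lower ?x < ereal b"
    using ereal_dense2[OF envelope_nth(2)[OF env len]] by auto
  \<comment> \<open>A cost in the last interval that exceeds the ratio of revenue to distance, so that the
    profit is negative.\<close>
  define c where "c = max (max b 1) (R I ?T / L I ?T + 1)"
  have "0 < c" "b \<le> c"
    by (simp_all add: c_def)
  then have c: "0 < c" "lower ?x \<le> ereal c"
    using less_le_trans[OF b, of "ereal c"] by (simp_all add: less_imp_le)
  have "optimal I {1..k} ?T c"
    using optimal_nth[OF len c(1)] c(2) envelope_last[OF env] by simp
  then have "G I {} c \<le> G I ?T c"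
    by (simp add: optimal_iff)
  then have "c * L I ?T \<le> R I ?T"
    by (simp add: G_def)
  moreover have "R I ?T / L I ?T < c"
    by (simp add: c_def)
  then have "R I ?T < c * L I ?T"
    using \<open>0 < L I ?T\<close> by (simp add: pos_divide_less_eq)
  ultimately show False
    by simp
qed

text \<open>At \<open>c = 0\<close> both sides hold for the first entry only: the full set is the unique optimal set,
  and the later intervals start at a positive cost.\<close>

lemma optimal_region_nth:
  assumes i: "i < length D"
  shows "{c. 0 \<le> c \<and> optimal I {1..k} (customers (D ! i)) c} =
    {c. lower (D ! i) \<le> ereal c \<and> ereal c \<le> upper (D ! i)}"
proof -
  have "0 \<le> c \<and> optimal I {1..k} (customers (D ! i)) c \<longleftrightarrow>
      lower (D ! i) \<le> ereal c \<and> ereal c \<le> upper (D ! i)" for c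
  proof (cases "c = 0")
    case True
    have "customers (D ! i) = {1..k} \<longleftrightarrow> i = 0"
      using customers_nested[of 0 i] customers_first i by auto
    moreover have "lower (D ! i) \<le> 0 \<longleftrightarrow> i = 0"
    proof (cases "i = 0")
      case False
      then have "upper (D ! 0) \<le> lower (D ! i)"
        using i by (intro envelope_ordered[OF env]) auto
      then show ?thesis
        using False envelope_first[OF env] envelope_nth(2)[OF env, of 0] by auto
    qed (simp add: envelope_first(2)[OF env])
    moreover have "0 \<le> upper (D ! i)"
      using envelope_nth(1,2)[OF env i] by (meson less_imp_le order_trans)
    ultimately show ?thesis
      using optimal_zero_iff[OF inst k] True by (simp flip: zero_ereal_def)
  next
    case False
    have "0 \<le> c" if "lower (D ! i) \<le> ereal c"
      using order_trans[OF envelope_nth(1)[OF env i] that] by simp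
    then show ?thesis
      using False optimal_nth[OF i, of c] by (cases "0 \<le> c") auto
  qed
  then show ?thesis
    by blast
qed

text \<open>An interval \<open>[a, b]\<close> on which \<open>T\<close> is optimal meets some interval of the envelope in more than a
  point: its midpoint \<open>c\<close> is covered, and the covering interval extends to at least one side of \<open>c\<close>.
  So \<open>T\<close> and the listed set are both optimal at two costs, hence equal.\<close>

lemma optimal_on_interval_iff:
  "(\<exists>a b. 0 \<le> a \<and> a < b \<and> (\<forall>c\<in>{a..b}. optimal I {1..k} T c)) \<longleftrightarrow>
   (\<exists>i<length D. T = customers (D ! i))"
proof (intro iffI; clarify)
  fix i
  assume i: "i < length D"
  obtain a where a: "lower (D ! i) < ereal a" "ereal a < upper (D ! i)"
    using ereal_dense2[OF envelope_nth(2)[OF env i]] by auto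
  obtain b where b: "ereal a < ereal b" "ereal b < upper (D ! i)"
    using ereal_dense2[OF a(2)] by auto
  have "0 < ereal a"
    using envelope_nth(1)[OF env i] a(1) by (rule le_less_trans)
  then have "0 < a"
    by simp
  moreover have "optimal I {1..k} (customers (D ! i)) c" if "c \<in> {a..b}" for c
  proof -
    have "ereal a \<le> ereal c"
      using that by simp
    then have "lower (D ! i) \<le> ereal c"
      using a(1) by (meson less_le_trans less_imp_le)
    moreover have "ereal c \<le> ereal b"
      using that by simp
    then have "ereal c \<le> upper (D ! i)"
      using b(2) by (meson le_less_trans less_imp_le)
    ultimately show ?thesis
      using optimal_nth[OF i, of c] \<open>0 < a\<close> that by auto
  qed
  ultimately show "\<exists>a b. 0 \<le> a \<and> a < b \<and> (\<forall>c\<in>{a..b}. optimal I {1..k} (customers (D ! i)) c)"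
    using b(1) by (intro exI[of _ a] exI[of _ b]) auto
next
  fix a b :: real
  assume ab: "0 \<le> a" "a < b" and opt: "\<forall>c\<in>{a..b}. optimal I {1..k} T c"
  define c where "c = (a + b) / 2"
  have c: "a < c" "c < b" "0 < c"
    using ab by (auto simp: c_def)
  obtain i where i: "i < length D" "lower (D ! i) \<le> ereal c" "ereal c \<le> upper (D ! i)"
    using envelope_cover_nth[OF env c(3)] .
  have opt_c: "optimal I {1..k} (customers (D ! i)) c"
    using optimal_nth[OF i(1) c(3)] i by simp
  have "T = customers (D ! i)"
  proof (cases "ereal c < upper (D ! i)")
    case True
    then have "ereal c < min (ereal b) (upper (D ! i))"
      using c by simp
    then obtain d where d: "ereal c < ereal d" "ereal d < min (ereal b) (upper (D ! i))"
      using ereal_dense2 by blast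
    then have "lower (D ! i) \<le> ereal d"
      using i(2) by (meson le_less_trans less_imp_le)
    moreover have "ereal d \<le> upper (D ! i)" "0 < d" "c < d" "d < b"
      using d c(3) by auto
    ultimately show ?thesis
      using opt c opt_c optimal_nth[OF i(1), of d] ab
      by (intro optimal_unique[OF inst k, of c d]) auto
  next
    case False
    then have "max (ereal a) (lower (D ! i)) < ereal c"
      using c envelope_nth(2)[OF env i(1)] by (simp add: not_less less_le_trans)
    then obtain d where d: "max (ereal a) (lower (D ! i)) < ereal d" "ereal d < ereal c"
      using ereal_dense2 by blast
    then have "ereal d \<le> upper (D ! i)"
      using i(3) by (meson less_le_trans less_imp_le)
    moreover have "lower (D ! i) \<le> ereal d" "a < d" "d < c" "0 < d"
      using d ab by auto
    ultimately show ?thesis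
      using opt c opt_c optimal_nth[OF i(1), of d] ab
      by (intro optimal_unique[OF inst k, of d c]) auto
  qed
  then show "\<exists>i<length D. T = customers (D ! i)"
    using i(1) by blast
qed

lemma breakpoint_iff:
  assumes "Suc i < length D"
  shows "G I (customers (D ! i)) c = G I (customers (D ! Suc i)) c \<longleftrightarrow> ereal c = upper (D ! i)"
proof -
  have i: "i < length D"
    using assms by simp
  have adj: "upper (D ! i) = lower (D ! Suc i)"
    by (rule envelope_adjacent[OF env assms])
  have "lower (D ! i) < upper (D ! i)" "upper (D ! i) < upper (D ! Suc i)" "0 \<le> lower (D ! i)"
    using envelope_nth(1,2)[OF env i] envelope_nth(2)[OF env assms] adj by auto
  then obtain d where d: "upper (D ! i) = ereal d" "0 < d"
    by (cases "upper (D ! i)") (auto dest: le_less_trans)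
  have "height (fst (D ! i)) d = PPTP I {1..k} d"
    using envelope_nth(2)[OF env i] envelope_nth(4)[OF env i d(2)] d(1) by (simp add: less_imp_le)
  moreover have "height (fst (D ! Suc i)) d = PPTP I {1..k} d"
    using envelope_nth(2)[OF env assms] envelope_nth(4)[OF env assms d(2)] d(1) adj
    by (simp add: less_imp_le)
  ultimately have eq: "height (fst (D ! i)) d = height (fst (D ! Suc i)) d"
    by simp
  have "dst (fst (D ! Suc i)) < dst (fst (D ! i))"
    by (rule envelope_steeper[OF env _ assms]) simp
  then have "height (fst (D ! i)) c = height (fst (D ! Suc i)) c \<longleftrightarrow> c = d"
    using height_diff[of "fst (D ! i)" c "fst (D ! Suc i)" d] eq by auto
  then show ?thesis
    by (simp add: height_nth[OF i] height_nth[OF assms] d(1))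
qed

lemma is_description_envelope:
  "is_description I k (map (\<lambda>x. (customers x, lower x, upper x)) D)"
  unfolding is_description_def
proof (intro exI conjI)
  let ?m = "length D"
  let ?S = "\<lambda>i. customers (D ! (i - 1))"
  let ?lo = "\<lambda>i. lower (D ! (i - 1))" and ?hi = "\<lambda>i. upper (D ! (i - 1))"
  note first = envelope_first[OF env]
  show "map (\<lambda>x. (customers x, lower x, upper x)) D = map (\<lambda>i. (?S i, ?lo i, ?hi i)) [1..<Suc ?m]"
    by (intro nth_equalityI) (simp_all del: upt_Suc)
  show "1 \<le> ?m"
    using first(1) by (simp add: Suc_le_eq)
  show "inj_on ?S {1..?m}"
  proof (rule linorder_inj_onI')
    fix i j
    assume "i \<in> {1..?m}" "j \<in> {1..?m}" "i < j"
    then have "?S j \<subset> ?S i"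
      by (intro customers_nested) auto
    then show "?S i \<noteq> ?S j"
      by blast
  qed
  show "?S 1 = {1..k}"
    using customers_first by simp
  show "?S ?m = {}"
    by (rule customers_last)
  have shift: "?S ` {1..?m} = {customers (D ! i) | i. i < ?m}"
  proof safe
    fix i
    assume "i < ?m"
    then show "customers (D ! i) \<in> ?S ` {1..?m}"
      by (intro image_eqI[of _ _ "Suc i"]) auto
  next
    fix i
    assume "i \<in> {1..?m}"
    then show "\<exists>j. ?S i = customers (D ! j) \<and> j < ?m"
      by (intro exI[of _ "i - 1"]) auto
  qed
  show "?S ` {1..?m} = {T. \<exists>a b. 0 \<le> a \<and> a < b \<and> (\<forall>c\<in>{a..b}. optimal I {1..k} T c)}"
    unfolding shift optimal_on_interval_iff by blast
  show "\<forall>i\<in>{1..?m}. ?lo i < ?hi i \<and>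
      {c. 0 \<le> c \<and> optimal I {1..k} (?S i) c} = {c. ?lo i \<le> ereal c \<and> ereal c \<le> ?hi i}"
  proof
    fix i
    assume "i \<in> {1..?m}"
    then have i: "i - 1 < ?m"
      by auto
    show "?lo i < ?hi i \<and>
        {c. 0 \<le> c \<and> optimal I {1..k} (?S i) c} = {c. ?lo i \<le> ereal c \<and> ereal c \<le> ?hi i}"
      using envelope_nth(2)[OF env i] optimal_region_nth[OF i] by (rule conjI)
  qed
  show "?lo 1 = 0"
    using first(2) by simp
  show "?hi ?m = \<infinity>"
    by (rule envelope_last[OF env])
  show "\<forall>i\<in>{1..<?m}. ?hi i = ?lo (i + 1) \<and>
      (\<forall>c. G I (?S i) c = G I (?S (i + 1)) c \<longleftrightarrow> ereal c = ?hi i)"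
  proof
    fix i
    assume "i \<in> {1..<?m}"
    then obtain j where j: "i = Suc j" "Suc j < ?m"
      by (cases i) auto
    then show "?hi i = ?lo (i + 1) \<and>
        (\<forall>c. G I (?S i) c = G I (?S (i + 1)) c \<longleftrightarrow> ereal c = ?hi i)"
      using envelope_adjacent[OF env j(2)] breakpoint_iff[OF j(2)] by simp
  qed
qed

end

section \<open>Operation counts\<close>

lemma steps_extend: "steps (extend I k s) = 13"
  by (simp add: extend_def)

lemma steps_extend_all: "steps (extend_all I k D) = 15 * length D + 1"
  by (induction I k D rule: extend_all.induct) (simp_all add: steps_extend)

lemma steps_beats: "steps (beats h e) \<le> 6"
  by (simp add: beats_def)

lemma steps_window: "steps (window h D) \<le> 9 * length D + 1"
proof (induction D)
  case (Cons x D)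
  obtain e a b where "x = (e, a, b)"
    by (cases x)
  then show ?case
    using Cons.IH steps_beats[of h e] by (simp add: split_beta)
qed simp

lemma cut_right_cost:
  "length (val (cut_right w D)) \<le> length D \<and> steps (cut_right w D) \<le> 4 * length D + 1"
proof (induction D)
  case (Cons x D)
  obtain e a b where "x = (e, a, b)"
    by (cases x)
  then show ?case
    using Cons.IH by simp
qed simp

lemma place_cost:
  "length (val (place h u w D)) \<le> length D + 1 \<and> steps (place h u w D) \<le> 5 * length D + 3"
proof (induction D)
  case (Cons x D)
  obtain e a b where x: "x = (e, a, b)"
    by (cases x)
  show ?case
    using Cons.IH cut_right_cost[of w "x # D"] by (simp add: x del: cut_right.simps)
qed simp

lemma insert_line_cost:
  "length (val (insert_line h D)) \<le> length D + 1 \<and> steps (insert_line h D) \<le> 14 * length D + 6"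
  using steps_window[of h D]
    place_cost[of h "fst (val (window h D))" "snd (val (window h D))" D]
  by (simp add: insert_line_def split_beta)

lemma steps_joint_sort_filter:
  "steps (joint_sort_filter D E) \<le> length E * (14 * (length D + length E) + 7) + 1"
proof (induction E arbitrary: D)
  case (Cons h E)
  let ?D = "val (insert_line h D)"
  let ?X = "14 * (length D + length (h # E)) + 7"
  have "length E * (14 * (length ?D + length E) + 7) \<le> length E * ?X"
    using insert_line_cost[of h D] by (intro mult_le_mono2) simp
  then have "steps (joint_sort_filter ?D E) \<le> length E * ?X + 1"
    using Cons.IH[of ?D] by linarith
  moreover have "steps (insert_line h D) + 1 \<le> ?X"
    using insert_line_cost[of h D] by simp
  moreover have "steps (joint_sort_filter D (h # E)) =
      steps (insert_line h D) + steps (joint_sort_filter ?D E) + 1"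
    by simp
  moreover have "length (h # E) * ?X = length E * ?X + ?X"
    by simp
  ultimately show ?case
    by linarith
qed simp

lemma strip_cost: "steps (strip D) = 2 * length D + 1"
  by (induction D rule: strip.induct) simp_all

lemma val_strip: "val (strip D) = map (\<lambda>x. (members (fst x), lower x, upper x)) D"
  by (induction D rule: strip.induct) simp_all

text \<open>By \<open>length_le\<close>, round \<open>k + 1\<close> inserts at most \<open>k + 1\<close> lines at linear cost each; its total of
  at most \<open>53 (k + 1)\<^sup>2\<close> operations does not exceed the increment of \<open>53 k\<^sup>3\<close>.\<close>

lemma steps_pptp_loop:
  assumes inst: "pptp_instance I" and "k \<le> num I"
  shows "steps (pptp_loop I k) \<le> 53 * k ^ 3 + 3"
  using assms(2)
proof (induction k)
  case 0
  then show ?case by simp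
next
  case (Suc k)
  let ?D = "val (pptp_loop I k)"
  let ?E = "val (extend_all I (Suc k) ?D)"
  have len: "length ?D \<le> k + 1"
    using envelope_pptp_loop[OF inst, of k] length_le[OF inst] Suc.prems by simp
  have "length ?E = length ?D"
    by (simp add: val_extend_all)
  then have "steps (joint_sort_filter ?D ?E) \<le> length ?D * (28 * length ?D + 7) + 1"
    using steps_joint_sort_filter[of ?D ?E] by (simp add: algebra_simps)
  also have "\<dots> \<le> (k + 1) * (28 * (k + 1) + 7) + 1"
    using len by (intro add_le_mono1 mult_le_mono) auto
  finally have "steps (pptp_loop I (Suc k)) \<le>
      (53 * k ^ 3 + 3) + (15 * (k + 1) + 1) + ((k + 1) * (28 * (k + 1) + 7) + 1) + 1"
    using Suc len by (simp add: steps_extend_all)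
  also have "\<dots> \<le> 53 * Suc k ^ 3 + 3"
    by (simp add: power3_eq_cube algebra_simps)
  finally show ?case .
qed

theorem theorem13:
  shows "(\<forall>I. pptp_instance I \<longrightarrow>
            is_description I (num I)
              (map (\<lambda>(S, a, b). (set S, a, b)) (val (pptp_line I)))) \<and>
         (\<exists>T :: nat \<Rightarrow> real. T \<in> O(\<lambda>n. real n ^ 3) \<and>
            (\<forall>I. pptp_instance I \<longrightarrow> real (steps (pptp_line I)) \<le> T (num I)))"
proof (intro conjI allI impI exI)
  fix I
  assume inst: "pptp_instance I"
  have "map (\<lambda>(S, a, b). (set S, a, b)) (val (pptp_line I)) =
      map (\<lambda>x. (customers x, lower x, upper x)) (val (pptp_loop I (num I)))"
    by (simp add: pptp_line_def val_strip)
  then show "is_description I (num I) (map (\<lambda>(S, a, b). (set S, a, b)) (val (pptp_line I)))"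
    using is_description_envelope[OF inst order_refl] envelope_pptp_loop[OF inst order_refl] by simp
next
  show "(\<lambda>n. 62 * real n ^ 3) \<in> O(\<lambda>n. real n ^ 3)"
    by simp
next
  fix I
  assume inst: "pptp_instance I"
  let ?n = "num I" and ?D = "val (pptp_loop I (num I))"
  have "length ?D \<le> ?n + 1"
    using length_le[OF inst order_refl] envelope_pptp_loop[OF inst order_refl] by simp
  then have "steps (pptp_line I) \<le> 53 * ?n ^ 3 + 2 * ?n + 7"
    using steps_pptp_loop[OF inst order_refl] by (simp add: pptp_line_def strip_cost)
  also have "\<dots> \<le> 62 * ?n ^ 3"
  proof -
    have "1 \<le> ?n"
      using inst by (simp add: pptp_instance_def)
    then have "?n \<le> ?n ^ 3"
      by (intro self_le_power) auto
    then show ?thesis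
      using \<open>1 \<le> ?n\<close> by simp
  qed
  finally show "real (steps (pptp_line I)) \<le> 62 * real ?n ^ 3"
    by (metis of_nat_le_iff of_nat_mult of_nat_numeral of_nat_power)
qed

end
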